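(* Let $k\ge4$ be even. For $0<\delta<1$ let $\mathcal F_\delta=\mathcal D\setminus\bigcup_{j=1}^3\{z\in\mathcal D:\ |z-e_j|\le\delta\}$ with $e_1=e^{\pi i/3}$, $e_2=i$, $e_3=e^{2\pi i/3}$. There exists an absolute constant $c_0>0$ such that, uniformly for all $0<\delta<1$, all $z=x+iy\in\mathcal F_\delta$ and all $w=u+iv\in\mathbb H^2$ with $|z-w|\le c_0\delta$, $$R_k(z,w)=2\Big(\frac{2i\sqrt{yv}}{z-\overline w}\Big)^k+O\Big(e^{-c_0\delta^2k}+y\,e^{-k/(17y^2)}\Big).$$
   Context: $\mathbb H^2=\{z=x+iy:\ y>0\}$, $\mathcal D=\{z\in\mathbb H^2:\ |\Re z|\le1/2,\ |z|\ge1\}$. For $\gamma=\begin{pmatrix}a&b\\c&d\end{pmatrix}\in\mathrm{SL}_2(\mathbb Z)$ acting by $\gamma z=\frac{az+b}{cz+d}$ and $z,w\in\mathbb H^2$, set $b_\gamma(z,w)=\frac{2i}{w+\gamma z}\cdot\frac{1}{cz+d}$. For $z=x+iy$, $w=u+iv\in\mathbb H^2$ and even $k\ge4$, define $$R_k(z,w)=(yv)^{k/2}\sum_{\gamma\in\mathrm{SL}_2(\mathbb Z)}b_\gamma(z,-\overline w)^k$$ (the normalized weight-$k$ Bergman kernel for cusp forms on $\mathrm{SL}_2(\mathbb Z)$). *)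

theory Defs
  imports "HOL-Analysis.Analysis"
begin

definition upper_half_plane :: "complex set" where
  "upper_half_plane = {z. Im z > 0}"

definition fund_domain :: "complex set" where
  "fund_domain = {z \<in> upper_half_plane. \<bar>Re z\<bar> \<le> 1/2 \<and> norm z \<ge> 1}"

definition SL2Z :: "(int^2^2) set" where
  "SL2Z = {\<gamma>. det \<gamma> = 1}"

definition aut_factor :: "int^2^2 \<Rightarrow> complex \<Rightarrow> complex" where
  "aut_factor \<gamma> z = of_int (\<gamma> $ 2 $ 1) * z + of_int (\<gamma> $ 2 $ 2)"

definition moebius_act :: "int^2^2 \<Rightarrow> complex \<Rightarrow> complex" where
  "moebius_act \<gamma> z = (of_int (\<gamma> $ 1 $ 1) * z + of_int (\<gamma> $ 1 $ 2)) / aut_factor \<gamma> z"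

definition bergman_b :: "int^2^2 \<Rightarrow> complex \<Rightarrow> complex \<Rightarrow> complex" where
  "bergman_b \<gamma> z w = 2 * \<i> / (w + moebius_act \<gamma> z) * (1 / aut_factor \<gamma> z)"

text \<open>The exponent \<open>k div 2\<close> is exact because the kernel is only used for even \<open>k\<close>. The sum is
  the unordered sum over the group; for \<open>k \<ge> 4\<close> the series converges absolutely.\<close>

definition R_kernel :: "nat \<Rightarrow> complex \<Rightarrow> complex \<Rightarrow> complex" where
  "R_kernel k z w = of_real ((Im z * Im w) ^ (k div 2)) *
     (\<Sum>\<^sub>\<infinity>\<gamma>\<in>SL2Z. bergman_b \<gamma> z (- cnj w) ^ k)"

definition F_region :: "real \<Rightarrow> complex set" where
  "F_region \<delta> = fund_domain -
     (\<Union>e\<in>{cis (pi / 3), \<i>, cis (2 * pi / 3)}. {z \<in> fund_domain. norm (z - e) \<le> \<delta>})"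

end

theory Submission
  imports Defs
begin

text \<open>
  The \<open>\<gamma>\<close>-term of \<open>R\<^sub>k(z, w)\<close> has absolute value \<open>Q\<^bsup>-k/2\<^esup>\<close>, where
  \<open>Q = cosh\<^sup>2 (dist(\<gamma>z, w) / 2)\<close>, and \<open>\<gamma> = \<plusminus>1\<close> give the main term.
  For the other translations \<open>Q \<ge> 1 + b\<^sup>2 / (6 y\<^sup>2)\<close>, and summing over \<open>b\<close> gives
  \<open>O(y exp(-k / (17 y\<^sup>2)))\<close>.
  If \<open>c \<noteq> 0\<close>, factor \<open>az + b - z (cz + d) = -c (z - \<zeta>) (z - \<zeta>')\<close> over the fixed points of \<open>\<gamma>\<close>. One
  of them, \<open>\<zeta>'\<close>, is not in the upper half plane, so if the left hand side is small then \<open>z\<close> is close to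
  \<open>\<zeta>\<close>, and the only fixed points close to the fundamental domain are the elliptic points. Hence
  \<open>Q \<ge> 1 + \<delta>\<^sup>2 / 200\<close>. Moreover \<open>Q\<close> dominates \<open>a\<^sup>2\<close>, \<open>c\<^sup>2\<close> and \<open>d\<^sup>2\<close> uniformly in \<open>z\<close>, and
  \<open>(a, c, d)\<close> determines \<open>\<gamma>\<close>, so \<open>Q\<^sup>-\<^sup>2\<close> has a bounded sum. Writing \<open>Q\<^bsup>-k/2\<^esup> = Q\<^sup>-\<^sup>2 Q\<^bsup>2-k/2\<^esup>\<close>
  combines the two bounds.
\<close>

section \<open>Unordered sums\<close>

lemma infsum_dominated_by_injective_image:
  fixes f :: "'a \<Rightarrow> 'b::banach" and g :: "'c \<Rightarrow> real"
  assumes g: "(g has_sum G) B" "\<And>y. y \<in> B \<Longrightarrow> 0 \<le> g y"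
    and h: "inj_on h A" "h ` A \<subseteq> B"
    and C: "0 \<le> C" and f: "\<And>x. x \<in> A \<Longrightarrow> norm (f x) \<le> C * g (h x)"
  shows "f summable_on A" "norm (infsum f A) \<le> C * G"
proof -
  have image: "g summable_on h ` A"
    using g(1) h(2) by (blast intro: summable_on_subset has_sum_imp_summable)
  hence "(\<lambda>x. g (h x)) summable_on A" using h(1) by (simp add: summable_on_reindex comp_def)
  hence majorant: "(\<lambda>x. C * g (h x)) summable_on A" by (rule summable_on_cmult_right)
  show f_summable: "f summable_on A"
    by (rule abs_summable_summable)
      (rule Infinite_Sum.abs_summable_on_comparison_test'[OF majorant f])
  have "norm (infsum f A) \<le> (\<Sum>\<^sub>\<infinity>x\<in>A. C * g (h x))"
    by (rule norm_infsum_le[OF has_sum_infsum[OF f_summable] has_sum_infsum[OF majorant] f])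
  also have "\<dots> = C * infsum g (h ` A)"
    by (simp add: infsum_cmult_right' infsum_reindex[OF h(1)] comp_def)
  also have "infsum g (h ` A) \<le> infsum g B"
    using image g h by (intro infsum_mono2) (auto intro: has_sum_imp_summable)
  also have "infsum g B = G" by (rule infsumI[OF g(1)])
  finally show "norm (infsum f A) \<le> C * G" using C by (simp add: mult_left_mono)
qed

lemma has_sum_mult_Times:
  fixes f :: "'a \<Rightarrow> real" and g :: "'b \<Rightarrow> real"
  assumes "(f has_sum F) A" "\<And>x. x \<in> A \<Longrightarrow> 0 \<le> f x"
    and "(g has_sum G) B" "\<And>y. y \<in> B \<Longrightarrow> 0 \<le> g y"
  shows "((\<lambda>(x, y). f x * g y) has_sum F * G) (A \<times> B)"
proof -
  let ?h = "\<lambda>(x, y). f x * g y"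
  have inner: "((\<lambda>y. ?h (x, y)) has_sum f x * G) B" for x
    using has_sum_cmult_right[OF assms(3)] by simp
  have outer: "((\<lambda>x. f x * G) has_sum F * G) A" by (rule has_sum_cmult_left[OF assms(1)])
  have "?h summable_on A \<times> B"
    by (rule summable_on_SigmaI[OF inner has_sum_imp_summable[OF outer]]) (simp add: assms(2,4))
  thus ?thesis by (rule has_sum_SigmaI[OF inner outer])
qed

lemma has_sum_int_even:
  fixes g :: "nat \<Rightarrow> real"
  assumes sums: "(\<lambda>n. g (Suc n)) sums S" and nonneg: "\<And>n. 0 \<le> g n"
  shows "((\<lambda>n::int. g (nat \<bar>n\<bar>)) has_sum g 0 + 2 * S) UNIV"
proof -
  have "g sums (S + g 0)" using sums by (rule iffD1[OF sums_Suc_iff])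
  hence "(g has_sum g 0 + S) UNIV"
    unfolding add.commute[of S] by (rule sums_nonneg_imp_has_sum[OF _ nonneg])
  hence "((\<lambda>n::int. g (nat \<bar>n\<bar>)) has_sum g 0 + S) (range int)"
    by (simp add: has_sum_reindex comp_def)
  moreover have "((\<lambda>n. g (Suc n)) has_sum S) UNIV"
    by (rule sums_nonneg_imp_has_sum[OF sums nonneg])
  hence "((\<lambda>n::int. g (nat \<bar>n\<bar>)) has_sum S) (range (\<lambda>n. - int (Suc n)))"
    by (subst has_sum_reindex) (simp_all add: comp_def inj_on_def nat_add_distrib)
  moreover have "range int \<inter> range (\<lambda>n. - int (Suc n)) = {}" by auto
  ultimately have "((\<lambda>n::int. g (nat \<bar>n\<bar>)) has_sum g 0 + S + S)
      (range int \<union> range (\<lambda>n. - int (Suc n)))"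
    by (rule has_sum_Un_disjoint)
  moreover have "m \<in> range int \<union> range (\<lambda>n. - int (Suc n))" for m
    by (cases m rule: int_cases) auto
  hence "range int \<union> range (\<lambda>n. - int (Suc n)) = UNIV" by blast
  ultimately show ?thesis by (simp add: add.commute)
qed

lemma arctan_diff_ge:
  assumes "0 \<le> u" "u < v"
  shows "(v - u) / (1 + v\<^sup>2) \<le> arctan v - arctan u"
proof -
  obtain t where t: "u < t" "t < v" "arctan v - arctan u = (v - u) * inverse (1 + t\<^sup>2)"
    using MVT2[OF assms(2), of arctan "\<lambda>t. inverse (1 + t\<^sup>2)"] DERIV_arctan by blast
  have "inverse (1 + v\<^sup>2) \<le> inverse (1 + t\<^sup>2)"
    using t assms by (intro le_imp_inverse_le) (auto intro: power_mono add_pos_nonneg)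
  thus ?thesis using t assms by (simp add: divide_inverse mult_left_mono)
qed

lemma sum_inverse_one_plus_sq_le:
  assumes "Y > 0"
  shows "(\<Sum>n<N. 1 / (1 + (real (Suc n) / Y)\<^sup>2)) \<le> Y * arctan (N / Y)"
proof (induction N)
  case (Suc N)
  have "Suc N / Y - N / Y = 1 / Y" by (simp flip: diff_divide_distrib)
  hence "1 / (1 + (Suc N / Y)\<^sup>2) = Y * ((Suc N / Y - N / Y) / (1 + (Suc N / Y)\<^sup>2))"
    using assms by simp
  also have "\<dots> \<le> Y * (arctan (Suc N / Y) - arctan (N / Y))"
    using assms by (intro mult_left_mono arctan_diff_ge) (auto simp: divide_strict_right_mono)
  finally have "1 / (1 + (Suc N / Y)\<^sup>2) \<le> Y * arctan (Suc N / Y) - Y * arctan (N / Y)"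
    by (simp only: right_diff_distrib)
  thus ?case using Suc.IH by simp
qed simp

lemma infsum_int_inverse_one_plus_sq:
  assumes "Y > 0"
  shows "(\<lambda>n::int. 1 / (1 + (real_of_int n / Y)\<^sup>2)) summable_on UNIV"
    and "(\<Sum>\<^sub>\<infinity>n::int. 1 / (1 + (real_of_int n / Y)\<^sup>2)) \<le> 1 + pi * Y"
proof -
  define g where "g n = 1 / (1 + (real n / Y)\<^sup>2)" for n
  have nonneg: "0 \<le> g n" for n by (simp add: g_def)
  have partial: "(\<Sum>n<N. g (Suc n)) \<le> Y * (pi / 2)" for N
  proof -
    have "(\<Sum>n<N. g (Suc n)) \<le> Y * arctan (N / Y)"
      unfolding g_def by (rule sum_inverse_one_plus_sq_le[OF assms])
    also have "\<dots> \<le> Y * (pi / 2)"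
      using assms arctan_ubound[of "N / Y"] by (intro mult_left_mono) auto
    finally show ?thesis .
  qed
  have summable: "summable (\<lambda>n. g (Suc n))"
    by (rule summableI_nonneg_bounded[OF nonneg partial])
  have "g (nat \<bar>n\<bar>) = 1 / (1 + (real_of_int n / Y)\<^sup>2)" for n
    by (simp add: g_def power_divide)
  hence has_sum: "((\<lambda>n::int. 1 / (1 + (real_of_int n / Y)\<^sup>2)) has_sum
      g 0 + 2 * (\<Sum>n. g (Suc n))) UNIV"
    using has_sum_int_even[of g, OF summable_sums[OF summable] nonneg] by simp
  show "(\<lambda>n::int. 1 / (1 + (real_of_int n / Y)\<^sup>2)) summable_on UNIV"
    by (rule has_sum_imp_summable[OF has_sum])
  have "g 0 = 1" by (simp add: g_def)
  moreover have "(\<Sum>n. g (Suc n)) \<le> Y * (pi / 2)"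
    by (rule suminf_le_const[OF summable partial])
  ultimately show "(\<Sum>\<^sub>\<infinity>n::int. 1 / (1 + (real_of_int n / Y)\<^sup>2)) \<le> 1 + pi * Y"
    using infsumI[OF has_sum] by (simp add: mult.commute)
qed

text \<open>The weight has a convergent sum over \<open>\<int>\<close>, while three factors yield the power \<open>-2\<close>.\<close>

definition entry_weight :: "int \<Rightarrow> real" where
  "entry_weight n = (1 + (real_of_int n)\<^sup>2) powr (-2/3)"

lemma entry_weight_nonneg: "0 \<le> entry_weight n"
  by (simp add: entry_weight_def)

lemma entry_weight_summable: "entry_weight summable_on UNIV"
proof -
  define g where "g n = (1 + (real n)\<^sup>2) powr (-2/3)" for n
  have "summable (\<lambda>n. g (Suc n))"
  proof (rule summable_comparison_test')
    show "summable (\<lambda>n. real (Suc n) powr (-4/3))"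
      by (subst summable_Suc_iff[of "\<lambda>n. real n powr (-4/3)"]) (simp add: summable_real_powr_iff)
    show "norm (g (Suc n)) \<le> real (Suc n) powr (-4/3)" for n
    proof -
      have "g (Suc n) \<le> (real (Suc n))\<^sup>2 powr (-2/3)"
        unfolding g_def by (intro powr_mono2') auto
      also have "\<dots> = real (Suc n) powr (-4/3)"
        by (simp add: powr_powr flip: powr_numeral)
      finally show ?thesis by (simp add: g_def)
    qed
  qed
  hence "(\<lambda>n::int. g (nat \<bar>n\<bar>)) summable_on UNIV"
    by (intro has_sum_imp_summable[OF has_sum_int_even[OF summable_sums]]) (auto simp: g_def)
  thus ?thesis by (simp add: g_def entry_weight_def[abs_def])
qed

lemma inverse_sq_le_prod_powr:
  fixes A B C X :: real
  assumes "0 < A" "A \<le> X" "0 < B" "B \<le> X" "0 < C" "C \<le> X"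
  shows "(1 / X)\<^sup>2 \<le> A powr (-2/3) * B powr (-2/3) * C powr (-2/3)"
proof -
  have "(1 / X)\<^sup>2 = X powr (-2)"
    using assms by (simp add: powr_minus powr_numeral divide_simps)
  also have "\<dots> = X powr (-2/3) * X powr (-2/3) * X powr (-2/3)"
    by (simp flip: powr_add)
  also have "\<dots> \<le> A powr (-2/3) * B powr (-2/3) * C powr (-2/3)"
    using assms by (intro mult_mono powr_mono2') auto
  finally show ?thesis .
qed

lemma power_inverse_le_exp:
  fixes Q s :: real
  assumes "p \<le> m" "real p * s \<le> 1" "exp s \<le> Q"
  shows "(1 / Q) ^ m \<le> 3 * (1 / Q) ^ p * exp (- s * real m)"
proof -
  have Q: "Q > 0" using assms(3) exp_gt_zero[of s] by linarith
  have "(1 / Q) ^ m = (1 / Q) ^ p * (1 / Q) ^ (m - p)"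
    using assms(1) by (simp flip: power_add)
  also have "\<dots> \<le> (1 / Q) ^ p * exp (- s) ^ (m - p)"
    using Q assms(3)
    by (intro mult_left_mono power_mono) (auto simp: exp_minus divide_simps)
  also have "exp (- s) ^ (m - p) = exp (real p * s) * exp (- s * real m)"
    using assms(1) by (simp add: of_nat_diff algebra_simps flip: exp_add exp_of_nat_mult)
  also have "\<dots> \<le> 3 * exp (- s * real m)"
  proof (rule mult_right_mono)
    have "exp (real p * s) \<le> exp 1" using assms(2) by simp
    thus "exp (real p * s) \<le> 3" using exp_le by linarith
  qed simp
  finally show ?thesis using Q by (simp add: mult_left_mono mult_ac)
qed

section \<open>The displacement of a point pair under a modular transformation\<close>

lemma SL2Z_iff: "\<gamma> \<in> SL2Z \<longleftrightarrow> \<gamma>$1$1 * \<gamma>$2$2 - \<gamma>$1$2 * \<gamma>$2$1 = 1"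
  by (simp add: SL2Z_def det_2)

lemma SL2Z_det_of_int:
  assumes "\<gamma> \<in> SL2Z"
  shows "of_int (\<gamma>$1$1) * of_int (\<gamma>$2$2) - of_int (\<gamma>$1$2) * of_int (\<gamma>$2$1) = (1 :: 'a :: ring_1)"
  using assms unfolding SL2Z_iff of_int_mult[symmetric] of_int_diff[symmetric] by simp

lemma matrix2_eq_iff:
  "\<gamma> = \<gamma>' \<longleftrightarrow> \<gamma>$1$1 = \<gamma>'$1$1 \<and> \<gamma>$1$2 = \<gamma>'$1$2 \<and> \<gamma>$2$1 = \<gamma>'$2$1 \<and> \<gamma>$2$2 = \<gamma>'$2$2"
  for \<gamma> \<gamma>' :: "'a^2^2"
  by (auto simp: vec_eq_iff forall_2)

lemma aut_factor_nonzero: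
  assumes "\<gamma> \<in> SL2Z" "Im z > 0"
  shows "aut_factor \<gamma> z \<noteq> 0"
proof
  assume "aut_factor \<gamma> z = 0"
  hence "Im (aut_factor \<gamma> z) = 0" "Re (aut_factor \<gamma> z) = 0" by simp_all
  hence "\<gamma>$2$1 = 0" "\<gamma>$2$2 = 0" using assms(2) by (auto simp: aut_factor_def)
  thus False using assms(1) by (simp add: SL2Z_iff)
qed

definition moebius_form :: "int^2^2 \<Rightarrow> complex \<Rightarrow> complex \<Rightarrow> complex" where
  "moebius_form \<gamma> z w = of_int (\<gamma>$1$1) * z + of_int (\<gamma>$1$2) - w * aut_factor \<gamma> z"

lemma moebius_form_eq:
  assumes "\<gamma> \<in> SL2Z" "Im z > 0"
  shows "moebius_form \<gamma> z w = (moebius_act \<gamma> z - w) * aut_factor \<gamma> z"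
  using aut_factor_nonzero[OF assms]
  by (simp add: moebius_form_def moebius_act_def left_diff_distrib)

text \<open>For \<open>z\<close> and \<open>w\<close> in the upper half plane, this is \<open>cosh\<^sup>2 (dist(\<gamma>z, w) / 2)\<close>.\<close>

definition displacement :: "int^2^2 \<Rightarrow> complex \<Rightarrow> complex \<Rightarrow> real" where
  "displacement \<gamma> z w = (norm (moebius_form \<gamma> z (cnj w)))\<^sup>2 / (4 * Im z * Im w)"

lemma displacement_eq:
  assumes "\<gamma> \<in> SL2Z" "Im z > 0" "Im w > 0"
  shows "displacement \<gamma> z w = 1 + (norm (moebius_form \<gamma> z w))\<^sup>2 / (4 * Im z * Im w)"
proof -
  have "(norm (moebius_form \<gamma> z (cnj w)))\<^sup>2 = (norm (moebius_form \<gamma> z w))\<^sup>2 + 4 * Im z * Im w *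
      (of_int (\<gamma>$1$1) * of_int (\<gamma>$2$2) - of_int (\<gamma>$1$2) * of_int (\<gamma>$2$1))"
    by (simp add: moebius_form_def aut_factor_def cmod_power2)
      (simp add: power2_eq_square algebra_simps)
  thus ?thesis
    using assms by (simp add: SL2Z_det_of_int displacement_def add_divide_distrib)
qed

lemma displacement_ge_1:
  assumes "\<gamma> \<in> SL2Z" "Im z > 0" "Im w > 0"
  shows "displacement \<gamma> z w \<ge> 1"
  using displacement_eq[OF assms] assms(2,3) by simp

lemma norm_ge_of_Im_mult_cnj:
  assumes "r * (norm q)\<^sup>2 \<le> Im (p * cnj q)"
  shows "r * norm q \<le> norm p"
proof (cases "q = 0")
  case False
  have "(r * norm q) * norm q \<le> norm p * norm q"
    using assms abs_Im_le_cmod[of "p * cnj q"] by (simp add: norm_mult power2_eq_square)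
  thus ?thesis using False by simp
qed simp

lemma norm_moebius_form_cnj_ge:
  assumes "\<gamma> \<in> SL2Z" "Im z > 0" "Im w > 0"
  shows "Im w * norm (aut_factor \<gamma> z) \<le> norm (moebius_form \<gamma> z (cnj w))"
    and "Im z * norm (of_int (\<gamma>$1$1) - of_int (\<gamma>$2$1) * w) \<le> norm (moebius_form \<gamma> z (cnj w))"
proof -
  have det: "real_of_int (\<gamma>$1$1) * of_int (\<gamma>$2$2) = 1 + of_int (\<gamma>$1$2) * of_int (\<gamma>$2$1)"
    using SL2Z_det_of_int[OF assms(1), where 'a = real] by linarith
  have "Im (moebius_form \<gamma> z (cnj w) * cnj (aut_factor \<gamma> z)) =
      Im z * (of_int (\<gamma>$1$1) * of_int (\<gamma>$2$2) - of_int (\<gamma>$1$2) * of_int (\<gamma>$2$1))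
      + Im w * (norm (aut_factor \<gamma> z))\<^sup>2"
    by (simp add: moebius_form_def aut_factor_def cmod_power2)
      (simp add: power2_eq_square algebra_simps)
  thus "Im w * norm (aut_factor \<gamma> z) \<le> norm (moebius_form \<gamma> z (cnj w))"
    using assms(2) det by (intro norm_ge_of_Im_mult_cnj) simp
  define q where "q = of_int (\<gamma>$1$1) - of_int (\<gamma>$2$1) * cnj w"
  have "Im (moebius_form \<gamma> z (cnj w) * cnj q) =
      Im w * (of_int (\<gamma>$1$1) * of_int (\<gamma>$2$2) - of_int (\<gamma>$1$2) * of_int (\<gamma>$2$1))
      + Im z * (norm q)\<^sup>2"
    by (simp add: moebius_form_def aut_factor_def cmod_power2 q_def)
      (simp add: power2_eq_square algebra_simps)
  hence "Im z * norm q \<le> norm (moebius_form \<gamma> z (cnj w))"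
    using assms(3) det by (intro norm_ge_of_Im_mult_cnj) simp
  moreover have "q = cnj (of_int (\<gamma>$1$1) - of_int (\<gamma>$2$1) * w)" by (simp add: q_def)
  ultimately show "Im z * norm (of_int (\<gamma>$1$1) - of_int (\<gamma>$2$1) * w)
      \<le> norm (moebius_form \<gamma> z (cnj w))"
    by (metis complex_mod_cnj)
qed

section \<open>Bounds near the fundamental domain\<close>

lemma fund_domain_Im_ge:
  assumes "z \<in> fund_domain"
  shows "Im z \<ge> 4/5"
proof -
  have "\<bar>Re z\<bar> \<le> 1/2" "1 \<le> norm z" "Im z > 0"
    using assms by (auto simp: fund_domain_def upper_half_plane_def)
  hence "(Re z)\<^sup>2 \<le> 1/4" "1 \<le> (norm z)\<^sup>2"
    using power_mono[of "\<bar>Re z\<bar>" "1/2" 2] power_mono[of 1 "norm z" 2]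
    by (simp_all add: power_divide)
  hence "(4/5)\<^sup>2 \<le> (Im z)\<^sup>2" by (simp add: cmod_power2 power_divide)
  thus ?thesis by (rule power2_le_imp_le) (use \<open>Im z > 0\<close> in simp)
qed

lemma near_fund_domain_Im:
  assumes "z \<in> fund_domain" "norm (z - w) \<le> 1/4"
  shows "Im z > 0" "Im w > 0" "Im z \<le> 2 * Im w" "Im w \<le> 2 * Im z"
  using abs_Im_le_cmod[of "z - w"] assms(2) fund_domain_Im_ge[OF assms(1)]
  unfolding minus_complex.sel by linarith+

lemma fund_domain_norm_linear_ge:
  fixes c d :: real
  assumes "z \<in> fund_domain"
  shows "c\<^sup>2 + d\<^sup>2 \<le> 2 * (norm (of_real c * z + of_real d))\<^sup>2"
proof -
  have x: "\<bar>Re z\<bar> \<le> 1/2" and "1 \<le> (norm z)\<^sup>2"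
    using assms power_mono[of 1 "norm z" 2] by (simp_all add: fund_domain_def)
  hence z: "c\<^sup>2 * 1 \<le> c\<^sup>2 * (norm z)\<^sup>2" by (intro mult_left_mono) auto
  have "4 * \<bar>c * d * Re z\<bar> = 2 * (2 * \<bar>Re z\<bar>) * (\<bar>c\<bar> * \<bar>d\<bar>)"
    by (simp add: abs_mult)
  also have "\<dots> \<le> 2 * 1 * (\<bar>c\<bar> * \<bar>d\<bar>)" using x by (intro mult_right_mono mult_left_mono) auto
  also have "\<dots> \<le> c\<^sup>2 + d\<^sup>2"
    using sum_squares_bound[of "\<bar>c\<bar>" "\<bar>d\<bar>"] by simp
  finally have "- 4 * (c * d * Re z) \<le> c\<^sup>2 + d\<^sup>2" by linarith
  moreover have "2 * (norm (of_real c * z + of_real d))\<^sup>2 =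
      2 * (c\<^sup>2 * (norm z)\<^sup>2) + 4 * (c * d * Re z) + 2 * d\<^sup>2"
    by (simp add: cmod_power2) (simp add: power2_eq_square algebra_simps)
  ultimately show ?thesis using z by linarith
qed

lemma displacement_ge_norm_sq:
  assumes "\<gamma> \<in> SL2Z" and zw: "z \<in> fund_domain" "norm (z - w) \<le> 1/4"
  shows "(norm (aut_factor \<gamma> z))\<^sup>2 \<le> 8 * displacement \<gamma> z w"
    and "(norm (of_int (\<gamma>$1$1) - of_int (\<gamma>$2$1) * w))\<^sup>2 \<le> 8 * displacement \<gamma> z w"
proof -
  note Im = near_fund_domain_Im[OF zw]
  let ?B = "norm (moebius_form \<gamma> z (cnj w))" and ?Q = "displacement \<gamma> z w"
  have bound: "q\<^sup>2 \<le> 8 * ?Q" if "r * q \<le> ?B" "r > 0" "q \<ge> 0" "Im z * Im w \<le> 2 * r\<^sup>2" for q r :: real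
  proof -
    have "r\<^sup>2 * q\<^sup>2 \<le> ?B\<^sup>2"
      using that by (simp add: power_mono flip: power_mult_distrib)
    also have "\<dots> = 4 * (Im z * Im w) * ?Q" using Im by (simp add: displacement_def)
    also have "\<dots> \<le> 4 * (2 * r\<^sup>2) * ?Q"
      using that displacement_ge_1[OF assms(1) Im(1,2)]
      by (intro mult_right_mono mult_left_mono) auto
    also have "\<dots> = r\<^sup>2 * (8 * ?Q)" by simp
    finally show ?thesis using that by simp
  qed
  show "(norm (aut_factor \<gamma> z))\<^sup>2 \<le> 8 * ?Q"
    using Im by (intro bound[OF norm_moebius_form_cnj_ge(1)[OF assms(1)]])
      (auto simp: power2_eq_square mult_right_mono)
  show "(norm (of_int (\<gamma>$1$1) - of_int (\<gamma>$2$1) * w))\<^sup>2 \<le> 8 * ?Q"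
    using Im by (intro bound[OF norm_moebius_form_cnj_ge(2)[OF assms(1)]])
      (auto simp: power2_eq_square mult_left_mono)
qed

lemma displacement_ge_entries:
  assumes \<gamma>: "\<gamma> \<in> SL2Z" and zw: "z \<in> fund_domain" "norm (z - w) \<le> 1/4"
    and n: "n \<in> {\<gamma>$1$1, \<gamma>$2$1, \<gamma>$2$2}"
  shows "1 + (real_of_int n)\<^sup>2 \<le> 40 * displacement \<gamma> z w"
proof -
  define a c d where "a = real_of_int (\<gamma>$1$1)" and "c = real_of_int (\<gamma>$2$1)"
    and "d = real_of_int (\<gamma>$2$2)"
  let ?Q = "displacement \<gamma> z w"
  have "c\<^sup>2 + d\<^sup>2 \<le> 2 * (norm (aut_factor \<gamma> z))\<^sup>2"
    using fund_domain_norm_linear_ge[OF zw(1), of c d] by (simp add: aut_factor_def c_def d_def)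
  hence cd: "c\<^sup>2 + d\<^sup>2 \<le> 16 * ?Q" using displacement_ge_norm_sq(1)[OF \<gamma> zw] by linarith
  have "norm (of_real (- c) * z + of_real a) =
      norm ((of_real a - of_real c * w) - of_real c * (z - w))"
    by (simp add: algebra_simps)
  also have "\<dots> \<le> norm (of_real a - of_real c * w) + \<bar>c\<bar> * norm (z - w)"
    by (metis norm_mult norm_of_real norm_triangle_ineq4)
  also have "\<dots> \<le> norm (of_real a - of_real c * w) + \<bar>c\<bar> / 4"
    using mult_left_mono[OF zw(2), of "\<bar>c\<bar>"] by simp
  finally have "(norm (of_real (- c) * z + of_real a))\<^sup>2
      \<le> (norm (of_real a - of_real c * w) + \<bar>c\<bar> / 4)\<^sup>2"
    by (intro power_mono) auto
  also have "\<dots> \<le> 2 * (norm (of_real a - of_real c * w))\<^sup>2 + 2 * (\<bar>c\<bar> / 4)\<^sup>2"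
    using sum_squares_bound[of "norm (of_real a - of_real c * w)" "\<bar>c\<bar> / 4"]
    by (simp add: power2_sum)
  also have "\<dots> \<le> 16 * ?Q + c\<^sup>2 / 8"
    using displacement_ge_norm_sq(2)[OF \<gamma> zw] by (simp add: power_divide a_def c_def)
  finally have "c\<^sup>2 + a\<^sup>2 \<le> 32 * ?Q + c\<^sup>2 / 4"
    using fund_domain_norm_linear_ge[OF zw(1), of "- c" a] by simp
  hence "a\<^sup>2 \<le> 32 * ?Q" "c\<^sup>2 \<le> 16 * ?Q" "d\<^sup>2 \<le> 16 * ?Q"
    using cd zero_le_power2[of c] zero_le_power2[of d] by linarith+
  moreover have "?Q \<ge> 1"
    by (rule displacement_ge_1[OF \<gamma> near_fund_domain_Im(1,2)[OF zw]])
  ultimately show ?thesis using n by (auto simp: a_def c_def d_def)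
qed

lemma inverse_displacement_sq_le:
  assumes "\<gamma> \<in> SL2Z" "z \<in> fund_domain" "norm (z - w) \<le> 1/4"
  shows "(1 / displacement \<gamma> z w)\<^sup>2 \<le>
    1600 * (entry_weight (\<gamma>$1$1) * entry_weight (\<gamma>$2$1) * entry_weight (\<gamma>$2$2))"
proof -
  have "(1 / (40 * displacement \<gamma> z w))\<^sup>2 \<le>
      entry_weight (\<gamma>$1$1) * entry_weight (\<gamma>$2$1) * entry_weight (\<gamma>$2$2)"
    unfolding entry_weight_def using displacement_ge_entries[OF assms]
    by (intro inverse_sq_le_prod_powr) (auto intro: add_pos_nonneg)
  moreover have "(1 / displacement \<gamma> z w)\<^sup>2 = 1600 * (1 / (40 * displacement \<gamma> z w))\<^sup>2"
    by (simp add: power_divide power_mult_distrib)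
  ultimately show ?thesis by linarith
qed

lemma displacement_translation_ge:
  assumes \<gamma>: "\<gamma> \<in> SL2Z" "\<gamma>$2$1 = 0" and z: "z \<in> fund_domain" and zw: "norm (z - w) \<le> 1/100"
  shows "displacement \<gamma> z w \<ge> 1 + (real_of_int (\<gamma>$1$2))\<^sup>2 / (6 * (Im z)\<^sup>2)"
proof -
  define a b where "a = \<gamma>$1$1" and "b = \<gamma>$1$2"
  have "norm (z - w) \<le> 1/4" using zw by simp
  note Im = near_fund_domain_Im[OF z this]
  have w: "Im w \<le> 81/80 * Im z"
    using abs_Im_le_cmod[of "z - w"] zw fund_domain_Im_ge[OF z] by simp
  have "a * \<gamma>$2$2 = 1" using \<gamma> by (simp add: SL2Z_iff a_def)
  hence d: "\<gamma>$2$2 = a" and a: "\<bar>a\<bar> = 1" by (auto simp: zmult_eq_1_iff)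
  have form: "moebius_form \<gamma> z w = of_int b + of_int a * (z - w)"
    using d \<gamma>(2) by (simp add: moebius_form_def aut_factor_def a_def b_def algebra_simps)
  have "99/100 * \<bar>real_of_int b\<bar> \<le> norm (moebius_form \<gamma> z w)"
  proof (cases "b = 0")
    case False
    hence "\<bar>real_of_int b\<bar> \<ge> 1" by linarith
    moreover have "norm (of_int a * (z - w)) \<le> 1/100"
      using a zw by (simp add: norm_mult flip: of_int_abs)
    moreover have "\<bar>real_of_int b\<bar> - norm (of_int a * (z - w)) \<le> norm (moebius_form \<gamma> z w)"
      unfolding form using norm_diff_ineq[of "of_int b" "of_int a * (z - w)"] by simp
    ultimately show ?thesis by linarith
  qed simp
  hence "(99/100 * \<bar>real_of_int b\<bar>)\<^sup>2 \<le> (norm (moebius_form \<gamma> z w))\<^sup>2"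
    by (intro power_mono) auto
  hence num: "(99/100)\<^sup>2 * (real_of_int b)\<^sup>2 \<le> (norm (moebius_form \<gamma> z w))\<^sup>2"
    unfolding power_mult_distrib power2_abs .
  have "4 * Im z * Im w \<le> 4 * Im z * (81/80 * Im z)" using w Im by (intro mult_left_mono) auto
  also have "\<dots> \<le> (99/100)\<^sup>2 * (6 * (Im z)\<^sup>2)" by (simp add: power2_eq_square)
  finally have den: "4 * Im z * Im w \<le> (99/100)\<^sup>2 * (6 * (Im z)\<^sup>2)" .
  have "(real_of_int b)\<^sup>2 / (6 * (Im z)\<^sup>2) =
      ((99/100)\<^sup>2 * (real_of_int b)\<^sup>2) / ((99/100)\<^sup>2 * (6 * (Im z)\<^sup>2))" by simp
  also have "\<dots> \<le> (norm (moebius_form \<gamma> z w))\<^sup>2 / (4 * Im z * Im w)"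
    using num den Im by (intro frac_le) auto
  finally show ?thesis using displacement_eq[OF \<gamma>(1) Im(1,2)] by (simp add: b_def)
qed

section \<open>The gap away from the elliptic points\<close>

text \<open>The fixed points of \<open>\<gamma>\<close> are real or form a conjugate pair. This one is never in the lower half
  plane.\<close>

definition fixed_point :: "int^2^2 \<Rightarrow> complex" where
  "fixed_point \<gamma> = of_real ((\<gamma>$1$1 - \<gamma>$2$2) / (2 * \<gamma>$2$1))
     + csqrt (of_real (real_of_int ((\<gamma>$1$1 + \<gamma>$2$2)\<^sup>2 - 4))) / of_real (2 * \<bar>\<gamma>$2$1\<bar>)"

lemma Im_fixed_point_nonneg: "Im (fixed_point \<gamma>) \<ge> 0"
  unfolding fixed_point_def csqrt_of_real' by simp

lemma Im_fixed_point_hyperbolic: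
  assumes "4 \<le> (\<gamma>$1$1 + \<gamma>$2$2)\<^sup>2"
  shows "Im (fixed_point \<gamma>) = 0"
proof -
  have "0 \<le> real_of_int ((\<gamma>$1$1 + \<gamma>$2$2)\<^sup>2 - 4)" using assms by (intro of_int_nonneg) simp
  thus ?thesis unfolding fixed_point_def csqrt_of_real' by simp
qed

lemma fixed_point_elliptic:
  assumes "(\<gamma>$1$1 + \<gamma>$2$2)\<^sup>2 < 4"
  shows "fixed_point \<gamma> = Complex ((\<gamma>$1$1 - \<gamma>$2$2) / (2 * \<gamma>$2$1))
    (sqrt (4 - (\<gamma>$1$1 + \<gamma>$2$2)\<^sup>2) / (2 * \<bar>\<gamma>$2$1\<bar>))"
proof -
  have "(\<gamma>$1$1 + \<gamma>$2$2)\<^sup>2 - 4 < 0" using assms by simp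
  hence "real_of_int ((\<gamma>$1$1 + \<gamma>$2$2)\<^sup>2 - 4) < 0" unfolding of_int_less_0_iff .
  thus ?thesis unfolding fixed_point_def csqrt_of_real' by (simp add: complex_eq_iff)
qed

lemma moebius_form_diag_factor:
  assumes \<gamma>: "\<gamma> \<in> SL2Z" "\<gamma>$2$1 \<noteq> 0"
  shows "moebius_form \<gamma> z z = - of_int (\<gamma>$2$1) * (z - fixed_point \<gamma>)
    * (z - (of_real ((\<gamma>$1$1 - \<gamma>$2$2) / \<gamma>$2$1) - fixed_point \<gamma>))"
proof -
  define a b c d where "a = real_of_int (\<gamma>$1$1)" and "b = real_of_int (\<gamma>$1$2)"
    and "c = real_of_int (\<gamma>$2$1)" and "d = real_of_int (\<gamma>$2$2)"
  define m where "m = (a - d) / (2 * c)"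
  define e where "e = csqrt (of_real ((a + d)\<^sup>2 - 4)) / of_real (2 * \<bar>c\<bar>)"
  have c: "c \<noteq> 0" using \<gamma>(2) by (simp add: c_def)
  have roots: "fixed_point \<gamma> = of_real m + e"
      "of_real ((a - d) / c) - fixed_point \<gamma> = of_real m - e"
    by (simp_all add: fixed_point_def a_def c_def d_def m_def e_def)
  have "a * d - b * c = 1"
    using SL2Z_det_of_int[OF \<gamma>(1), where 'a = real] by (simp add: a_def b_def c_def d_def)
  hence disc: "(a + d)\<^sup>2 - 4 = (a - d)\<^sup>2 + 4 * b * c" by (simp add: power2_eq_square algebra_simps)
  have "e\<^sup>2 = of_real (((a + d)\<^sup>2 - 4) / (4 * c\<^sup>2))"
    by (simp add: e_def power_divide power_mult_distrib flip: of_real_power)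
  also have "((a + d)\<^sup>2 - 4) / (4 * c\<^sup>2) = m\<^sup>2 + b / c"
    using c unfolding disc by (simp add: m_def field_simps power2_eq_square)
  finally have "of_real c * e\<^sup>2 = of_real c * (of_real m)\<^sup>2 + of_real b"
    using c by (simp add: distrib_left)
  hence "- of_real c * (z - (of_real m + e)) * (z - (of_real m - e)) =
      of_real b + of_real (2 * c * m) * z - of_real c * z\<^sup>2"
    by (simp add: algebra_simps power2_eq_square)
  also have "2 * c * m = a - d" using c by (simp add: m_def)
  also have "of_real b + of_real (a - d) * z - of_real c * z\<^sup>2 = moebius_form \<gamma> z z"
    by (simp add: moebius_form_def aut_factor_def a_def b_def c_def d_def algebra_simps
        power2_eq_square)
  finally show ?thesis
    using roots by (simp add: a_def c_def d_def)
qed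

lemma norm_moebius_form_diag_ge:
  assumes \<gamma>: "\<gamma> \<in> SL2Z" "\<gamma>$2$1 \<noteq> 0"
  shows "\<bar>of_int (\<gamma>$2$1)\<bar> * norm (z - fixed_point \<gamma>) * Im z \<le> norm (moebius_form \<gamma> z z)"
proof -
  let ?\<zeta>' = "of_real ((\<gamma>$1$1 - \<gamma>$2$2) / \<gamma>$2$1) - fixed_point \<gamma>"
  have "Im z \<le> Im (z - ?\<zeta>')" using Im_fixed_point_nonneg[of \<gamma>] by simp
  also have "\<dots> \<le> norm (z - ?\<zeta>')" using abs_Im_le_cmod[of "z - ?\<zeta>'"] by linarith
  finally have "\<bar>of_int (\<gamma>$2$1)\<bar> * norm (z - fixed_point \<gamma>) * Im z \<le>
      \<bar>of_int (\<gamma>$2$1)\<bar> * norm (z - fixed_point \<gamma>) * norm (z - ?\<zeta>')"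
    by (intro mult_left_mono) auto
  also have "\<dots> = norm (moebius_form \<gamma> z z)"
    unfolding moebius_form_diag_factor[OF \<gamma>] by (simp only: norm_mult norm_minus_cancel norm_of_int)
  finally show ?thesis .
qed

abbreviation elliptic_points :: "complex set" where
  "elliptic_points \<equiv> {cis (pi / 3), \<i>, cis (2 * pi / 3)}"

lemma fixed_point_in_elliptic_points:
  assumes c: "\<gamma>$2$1 \<noteq> 0" and Re: "\<bar>Re (fixed_point \<gamma>)\<bar> < 1" and Im: "Im (fixed_point \<gamma>) > 1/2"
  shows "fixed_point \<gamma> \<in> elliptic_points"
proof -
  define p t c where "p = \<gamma>$1$1 - \<gamma>$2$2" and "t = \<gamma>$1$1 + \<gamma>$2$2" and "c = \<gamma>$2$1"
  have disc: "t\<^sup>2 < 2\<^sup>2"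
    using Im_fixed_point_hyperbolic[of \<gamma>] Im by (cases "t\<^sup>2 < 4") (auto simp: t_def)
  hence t: "\<bar>t\<bar> < 2" by (intro power2_less_imp_less[of "\<bar>t\<bar>"]) auto
  have Re_\<zeta>: "Re (fixed_point \<gamma>) = p / (2 * c)"
    and Im_\<zeta>: "Im (fixed_point \<gamma>) = sqrt (4 - t\<^sup>2) / (2 * \<bar>c\<bar>)"
    using fixed_point_elliptic[of \<gamma>] disc by (simp_all add: p_def t_def c_def)
  have "sqrt (4 - t\<^sup>2) \<le> sqrt (2\<^sup>2)" by (rule real_sqrt_le_mono) simp
  hence "\<bar>real_of_int c\<bar> < 2" using Im c unfolding Im_\<zeta> by (simp add: c_def field_simps)
  hence c1: "\<bar>c\<bar> = 1" using c unfolding c_def by linarith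
  hence "\<bar>real_of_int p\<bar> < 2" using Re unfolding Re_\<zeta> by (auto simp: abs_if split: if_splits)
  hence "p = -1 \<or> p = 0 \<or> p = 1" by linarith
  moreover have "t = -1 \<or> t = 0 \<or> t = 1" "c = 1 \<or> c = -1" using t c1 by linarith+
  moreover have "even (p + t)" by (simp add: p_def t_def)
  ultimately consider "t = 0" "p = 0" | "t = 1 \<or> t = -1" "p = c" | "t = 1 \<or> t = -1" "p = - c"
    by (elim disjE) auto
  thus ?thesis
  proof cases
    case 1
    hence "fixed_point \<gamma> = \<i>" using Re_\<zeta> Im_\<zeta> c1 by (simp add: complex_eq_iff)
    thus ?thesis by simp
  next
    case 2
    hence "fixed_point \<gamma> = cis (pi / 3)"
      using Re_\<zeta> Im_\<zeta> c1 by (auto simp: complex_eq_iff cos_60 sin_60)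
    thus ?thesis by simp
  next
    case 3
    hence "fixed_point \<gamma> = cis (2 * pi / 3)"
      using Re_\<zeta> Im_\<zeta> c1 by (auto simp: complex_eq_iff cos_120 sin_120)
    thus ?thesis by simp
  qed
qed

lemma F_regionD:
  assumes "z \<in> F_region \<delta>"
  shows "z \<in> fund_domain" "\<And>e. e \<in> elliptic_points \<Longrightarrow> norm (z - e) > \<delta>"
  using assms by (auto simp: F_region_def)

lemma norm_moebius_form_diag_gap:
  assumes \<gamma>: "\<gamma> \<in> SL2Z" "\<gamma>$2$1 \<noteq> 0" and z: "z \<in> F_region \<delta>" and \<delta>: "\<delta> < 1"
  shows "norm (moebius_form \<gamma> z z) > \<delta> / 4 * Im z"
proof (rule ccontr)
  let ?\<zeta> = "fixed_point \<gamma>"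
  assume small: "\<not> ?thesis"
  have x: "\<bar>Re z\<bar> \<le> 1/2" and y: "Im z \<ge> 4/5"
    using F_regionD(1)[OF z] fund_domain_Im_ge by (auto simp: fund_domain_def)
  have "\<bar>real_of_int (\<gamma>$2$1)\<bar> \<ge> 1" using \<gamma>(2) by linarith
  hence "1 * (norm (z - ?\<zeta>) * Im z) \<le> \<bar>of_int (\<gamma>$2$1)\<bar> * (norm (z - ?\<zeta>) * Im z)"
    using y by (intro mult_right_mono) auto
  also have "\<dots> \<le> \<delta> / 4 * Im z"
    using norm_moebius_form_diag_ge[OF \<gamma>, of z] small unfolding mult.assoc by linarith
  finally have close: "norm (z - ?\<zeta>) \<le> \<delta> / 4" using y by simp
  hence "\<bar>Re z - Re ?\<zeta>\<bar> < 1/4" "\<bar>Im z - Im ?\<zeta>\<bar> < 1/4"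
    using abs_Re_le_cmod[of "z - ?\<zeta>"] abs_Im_le_cmod[of "z - ?\<zeta>"] \<delta> by auto
  hence "?\<zeta> \<in> elliptic_points"
    using x y \<gamma>(2) by (intro fixed_point_in_elliptic_points) linarith+
  hence "\<delta> < norm (z - ?\<zeta>)" by (rule F_regionD(2)[OF z])
  thus False using close norm_ge_zero[of "z - ?\<zeta>"] by linarith
qed

lemma norm_moebius_form_gap:
  assumes \<gamma>: "\<gamma> \<in> SL2Z" "\<gamma>$2$1 \<noteq> 0" and z: "z \<in> F_region \<delta>"
    and \<delta>: "0 < \<delta>" "\<delta> < 1" and zw: "norm (z - w) \<le> \<delta> / 100"
    and aut_factor: "norm (aut_factor \<gamma> z) \<le> 4"
  shows "norm (moebius_form \<gamma> z w) \<ge> \<delta> / 5 * Im z"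
proof -
  have "moebius_form \<gamma> z z = moebius_form \<gamma> z w - (z - w) * aut_factor \<gamma> z"
    by (simp add: moebius_form_def algebra_simps)
  hence "norm (moebius_form \<gamma> z z) \<le>
      norm (moebius_form \<gamma> z w) + norm (z - w) * norm (aut_factor \<gamma> z)"
    by (metis norm_mult norm_triangle_ineq4)
  also have "norm (z - w) * norm (aut_factor \<gamma> z) \<le> \<delta> / 100 * 4"
    using zw aut_factor \<delta> by (intro mult_mono) auto
  also have "\<dots> \<le> \<delta> / 20 * Im z"
    using \<delta> fund_domain_Im_ge[OF F_regionD(1)[OF z]] by (simp add: field_simps)
  finally show ?thesis using norm_moebius_form_diag_gap[OF \<gamma> z \<delta>(2)] by linarith
qed

lemma displacement_gap:
  assumes \<gamma>: "\<gamma> \<in> SL2Z" "\<gamma>$2$1 \<noteq> 0" and z: "z \<in> F_region \<delta>"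
    and \<delta>: "0 < \<delta>" "\<delta> < 1" and zw: "norm (z - w) \<le> \<delta> / 100"
  shows "displacement \<gamma> z w \<ge> 1 + \<delta>\<^sup>2 / 200"
proof -
  note zD = F_regionD(1)[OF z]
  have near: "norm (z - w) \<le> 1/4" using zw \<delta> by linarith
  note Im = near_fund_domain_Im[OF zD near]
  show ?thesis
  proof (cases "norm (aut_factor \<gamma> z) \<le> 4")
    case True
    hence "\<delta> / 5 * Im z \<le> norm (moebius_form \<gamma> z w)"
      by (rule norm_moebius_form_gap[OF \<gamma> z \<delta> zw])
    hence "(\<delta> / 5 * Im z)\<^sup>2 \<le> (norm (moebius_form \<gamma> z w))\<^sup>2"
      using \<delta> Im by (intro power_mono) auto
    moreover have "4 * Im z * Im w \<le> 4 * Im z * (2 * Im z)"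
      using Im by (intro mult_left_mono) auto
    ultimately have "(\<delta> / 5 * Im z)\<^sup>2 / (4 * Im z * (2 * Im z)) \<le>
        (norm (moebius_form \<gamma> z w))\<^sup>2 / (4 * Im z * Im w)"
      using Im by (intro frac_le) auto
    also have "(\<delta> / 5 * Im z)\<^sup>2 / (4 * Im z * (2 * Im z)) = \<delta>\<^sup>2 / 200"
      using Im by (simp add: power2_eq_square)
    finally show ?thesis using displacement_eq[OF \<gamma>(1) Im(1,2)] by simp
  next
    case False
    have "(norm (aut_factor \<gamma> z))\<^sup>2 \<le> 8 * displacement \<gamma> z w"
      by (rule displacement_ge_norm_sq(1)[OF \<gamma>(1) zD near])
    moreover have "4\<^sup>2 \<le> (norm (aut_factor \<gamma> z))\<^sup>2" using False by (intro power_mono) auto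
    moreover have "\<delta>\<^sup>2 \<le> 1" using \<delta> by (simp add: power_le_one)
    ultimately show ?thesis by simp
  qed
qed

section \<open>The terms of the kernel\<close>

definition kernel_term :: "nat \<Rightarrow> complex \<Rightarrow> complex \<Rightarrow> int^2^2 \<Rightarrow> complex" where
  "kernel_term k z w \<gamma> = of_real ((Im z * Im w) ^ (k div 2)) * bergman_b \<gamma> z (- cnj w) ^ k"

lemma R_kernel_eq_infsum: "R_kernel k z w = infsum (kernel_term k z w) SL2Z"
  unfolding R_kernel_def kernel_term_def by (rule infsum_cmult_right'[symmetric])

lemma norm_kernel_term:
  assumes \<gamma>: "\<gamma> \<in> SL2Z" and Im: "Im z > 0" "Im w > 0" and k: "even k"
  shows "norm (kernel_term k z w \<gamma>) = (1 / displacement \<gamma> z w) ^ (k div 2)"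
proof -
  obtain m where m: "k = 2 * m" using k by (rule evenE)
  let ?B = "moebius_form \<gamma> z (cnj w)"
  have "bergman_b \<gamma> z (- cnj w) = 2 * \<i> / ?B"
    by (simp add: bergman_b_def moebius_form_eq[OF \<gamma> Im(1)])
  hence "norm (kernel_term k z w \<gamma>) = (Im z * Im w) ^ m * (2 / norm ?B) ^ k"
    using Im by (simp add: kernel_term_def m norm_mult norm_power norm_divide)
  also have "\<dots> = (Im z * Im w * (2 / norm ?B)\<^sup>2) ^ m"
    by (simp add: m power_mult power_mult_distrib)
  also have "Im z * Im w * (2 / norm ?B)\<^sup>2 = 1 / displacement \<gamma> z w"
    by (simp add: displacement_def power_divide)
  finally show ?thesis by (simp add: m)
qed

lemma kernel_term_central:
  assumes \<gamma>: "\<gamma> \<in> {mat 1, - mat 1}" and Im: "Im z > 0" "Im w > 0" and k: "even k"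
  shows "kernel_term k z w \<gamma> = (2 * \<i> * of_real (sqrt (Im z * Im w)) / (z - cnj w)) ^ k"
proof -
  obtain m where m: "k = 2 * m" using k by (rule evenE)
  have "bergman_b \<gamma> z (- cnj w) \<in> {2 * \<i> / (z - cnj w), - (2 * \<i> / (z - cnj w))}"
    using \<gamma> by (auto simp: bergman_b_def moebius_act_def aut_factor_def mat_def minus_divide_right)
  hence "bergman_b \<gamma> z (- cnj w) ^ k = (2 * \<i> / (z - cnj w)) ^ k" using k by auto
  moreover have "(Im z * Im w) ^ m = sqrt (Im z * Im w) ^ k"
    using Im by (simp add: m power_mult)
  ultimately show ?thesis
    by (simp add: kernel_term_def m power_mult_distrib power_divide)
qed

definition nontrivial_translations :: "(int^2^2) set" where
  "nontrivial_translations = {\<gamma> \<in> SL2Z. \<gamma>$2$1 = 0 \<and> \<gamma>$1$2 \<noteq> 0}"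

definition nontranslations :: "(int^2^2) set" where
  "nontranslations = {\<gamma> \<in> SL2Z. \<gamma>$2$1 \<noteq> 0}"

lemma R_kernel_decomposition:
  assumes Im: "Im z > 0" "Im w > 0" and k: "even k"
    and summable: "kernel_term k z w summable_on nontrivial_translations"
      "kernel_term k z w summable_on nontranslations"
  shows "R_kernel k z w = 2 * (2 * \<i> * of_real (sqrt (Im z * Im w)) / (z - cnj w)) ^ k
    + (infsum (kernel_term k z w) nontrivial_translations
      + infsum (kernel_term k z w) nontranslations)"
proof -
  let ?f = "kernel_term k z w"
  have partition: "SL2Z = {mat 1, - mat 1} \<union> (nontrivial_translations \<union> nontranslations)"
    by (auto simp: nontrivial_translations_def nontranslations_def SL2Z_iff matrix2_eq_iff mat_def
        zmult_eq_1_iff)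
  have disjoint: "{mat 1, - mat 1} \<inter> (nontrivial_translations \<union> nontranslations) = {}"
      "nontrivial_translations \<inter> nontranslations = {}"
    by (auto simp: nontrivial_translations_def nontranslations_def mat_def)
  have "R_kernel k z w =
      infsum ?f {mat 1, - mat 1} + infsum ?f (nontrivial_translations \<union> nontranslations)"
    unfolding R_kernel_eq_infsum partition using summable disjoint
    by (intro infsum_Un_disjoint summable_on_Un_disjoint) auto
  also have "infsum ?f (nontrivial_translations \<union> nontranslations) =
      infsum ?f nontrivial_translations + infsum ?f nontranslations"
    by (rule infsum_Un_disjoint[OF summable disjoint(2)])
  finally have "R_kernel k z w = infsum ?f {mat 1, - mat 1}
      + (infsum ?f nontrivial_translations + infsum ?f nontranslations)" .
  moreover have "(mat 1 :: int^2^2) \<noteq> - mat 1" by (simp add: matrix2_eq_iff mat_def)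
  ultimately show ?thesis using kernel_term_central[OF _ Im k] by simp
qed

section \<open>The error terms\<close>

lemma exp_le_one_plus_inverse_sq:
  fixes y :: real
  assumes "y \<ge> 4/5"
  shows "exp (2 / (17 * y\<^sup>2)) \<le> 1 + 1 / (6 * y\<^sup>2)"
proof -
  define s where "s = 2 / (17 * y\<^sup>2)"
  have y: "y > 0" "(4/5)\<^sup>2 \<le> y\<^sup>2" using assms by (auto intro!: power_mono)
  hence s: "0 \<le> s" "s \<le> 1/5" by (auto simp: s_def divide_simps)
  have "exp s \<le> 1 + s + s\<^sup>2" using s by (intro exp_bound) auto
  also have "s\<^sup>2 \<le> s * (1/5)" unfolding power2_eq_square using s by (intro mult_left_mono) auto
  also have "1 + s + s * (1/5) \<le> 1 + 1 / (6 * y\<^sup>2)" using y by (simp add: s_def divide_simps)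
  finally show ?thesis by (simp add: s_def)
qed

lemma nontrivial_translation_term_le:
  assumes \<gamma>: "\<gamma> \<in> nontrivial_translations" and z: "z \<in> fund_domain"
    and zw: "norm (z - w) \<le> 1/100" and k: "even k" "k \<ge> 2"
  shows "norm (kernel_term k z w \<gamma>) \<le>
    3 * exp (- real k / (17 * (Im z)\<^sup>2)) * (1 / (1 + (real_of_int (\<gamma>$1$2) / (3 * Im z))\<^sup>2))"
proof -
  obtain m where m: "k = 2 * m" using k(1) by (rule evenE)
  define y b s where "y = Im z" and "b = real_of_int (\<gamma>$1$2)" and "s = 2 / (17 * y\<^sup>2)"
  let ?Q = "displacement \<gamma> z w"
  have \<gamma>': "\<gamma> \<in> SL2Z" "\<gamma>$2$1 = 0" "\<gamma>$1$2 \<noteq> 0" using \<gamma> by (auto simp: nontrivial_translations_def)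
  have "norm (z - w) \<le> 1/4" using zw by simp
  note Im = near_fund_domain_Im[OF z this]
  have y: "y \<ge> 4/5" unfolding y_def by (rule fund_domain_Im_ge[OF z])
  have Q: "?Q \<ge> 1 + b\<^sup>2 / (6 * y\<^sup>2)"
    unfolding b_def y_def by (rule displacement_translation_ge[OF \<gamma>'(1,2) z zw])
  have "(4/5)\<^sup>2 \<le> y\<^sup>2" using y by (intro power_mono) auto
  hence s: "s \<le> 1" by (simp add: s_def divide_simps)
  have "\<bar>b\<bar> \<ge> 1" using \<gamma>'(3) unfolding b_def by linarith
  hence b: "b\<^sup>2 \<ge> 1" using abs_le_square_iff[of 1 b] by simp
  have "exp s \<le> 1 + 1 / (6 * y\<^sup>2)" unfolding s_def by (rule exp_le_one_plus_inverse_sq[OF y])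
  also have "\<dots> \<le> 1 + b\<^sup>2 / (6 * y\<^sup>2)" using b by (intro add_left_mono divide_right_mono) auto
  also note Q
  finally have "(1 / ?Q) ^ m \<le> 3 * (1 / ?Q) ^ 1 * exp (- s * real m)"
    using k m s by (intro power_inverse_le_exp) auto
  also have "1 / ?Q \<le> 1 / (1 + (b / (3 * y))\<^sup>2)"
  proof (intro divide_left_mono)
    have "b\<^sup>2 / (9 * y\<^sup>2) \<le> b\<^sup>2 / (6 * y\<^sup>2)" using y by (intro divide_left_mono) auto
    thus "1 + (b / (3 * y))\<^sup>2 \<le> ?Q" using Q by (simp add: power_divide power_mult_distrib)
  qed (use displacement_ge_1[OF \<gamma>'(1) Im(1,2)] in \<open>auto intro!: mult_pos_pos add_pos_nonneg\<close>)
  finally have "(1 / ?Q) ^ m \<le> 3 * exp (- s * real m) * (1 / (1 + (b / (3 * y))\<^sup>2))"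
    by (simp add: mult_ac)
  moreover have "- s * real m = - real k / (17 * y\<^sup>2)" by (simp add: s_def m)
  ultimately show ?thesis
    using norm_kernel_term[OF \<gamma>'(1) Im(1,2) k(1)] by (simp add: m y_def b_def)
qed

lemma nontrivial_translations_entries_inj:
  "inj_on (\<lambda>\<gamma>. (\<gamma>$1$1, \<gamma>$1$2)) nontrivial_translations"
  "(\<lambda>\<gamma>. (\<gamma>$1$1, \<gamma>$1$2)) ` nontrivial_translations \<subseteq> {1, -1} \<times> UNIV"
  by (auto simp: inj_on_def nontrivial_translations_def SL2Z_iff matrix2_eq_iff zmult_eq_1_iff)

lemma nontrivial_translations_sum_le:
  assumes z: "z \<in> fund_domain" and zw: "norm (z - w) \<le> 1/100" and k: "even k" "k \<ge> 2"
  shows "kernel_term k z w summable_on nontrivial_translations"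
    and "norm (infsum (kernel_term k z w) nontrivial_translations) \<le>
      84 * (Im z * exp (- real k / (17 * (Im z)\<^sup>2)))"
proof -
  define h where "h b = 1 / (1 + (real_of_int b / (3 * Im z))\<^sup>2)" for b
  define E where "E = 3 * exp (- real k / (17 * (Im z)\<^sup>2))"
  have y: "Im z \<ge> 4/5" by (rule fund_domain_Im_ge[OF z])
  have h: "h summable_on UNIV" "infsum h UNIV \<le> 1 + pi * (3 * Im z)"
    unfolding h_def using y by (auto intro!: infsum_int_inverse_one_plus_sq)
  have "((\<lambda>_. 1) has_sum (2::real)) {1, -1 :: int}" by (rule has_sum_finiteI) simp_all
  hence "((\<lambda>(a, b). 1 * h b) has_sum 2 * infsum h UNIV) ({1, -1 :: int} \<times> UNIV)"
    by (rule has_sum_mult_Times[OF _ _ has_sum_infsum[OF h(1)]]) (auto simp: h_def)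
  note dominated = infsum_dominated_by_injective_image[OF this _ nontrivial_translations_entries_inj,
      of E "kernel_term k z w"]
  have "norm (kernel_term k z w \<gamma>) \<le> E * h (\<gamma>$1$2)" if "\<gamma> \<in> nontrivial_translations" for \<gamma>
    unfolding E_def h_def by (rule nontrivial_translation_term_le[OF that z zw k])
  hence summable: "kernel_term k z w summable_on nontrivial_translations"
    and bound: "norm (infsum (kernel_term k z w) nontrivial_translations) \<le> E * (2 * infsum h UNIV)"
    using dominated by (auto simp: h_def E_def)
  show "kernel_term k z w summable_on nontrivial_translations" by (rule summable)
  have "pi * (3 * Im z) \<le> 4 * (3 * Im z)" using y pi_less_4 by (intro mult_right_mono) auto
  hence "infsum h UNIV \<le> 14 * Im z" using h(2) y by linarith
  hence "E * (2 * infsum h UNIV) \<le> E * (28 * Im z)" by (intro mult_left_mono) (auto simp: E_def)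
  also have "\<dots> = 84 * (Im z * exp (- real k / (17 * (Im z)\<^sup>2)))" by (simp add: E_def)
  finally show "norm (infsum (kernel_term k z w) nontrivial_translations) \<le>
      84 * (Im z * exp (- real k / (17 * (Im z)\<^sup>2)))"
    using bound by (rule order_trans[rotated])
qed

lemma nontranslation_term_le:
  assumes \<gamma>: "\<gamma> \<in> nontranslations" and z: "z \<in> F_region \<delta>" and \<delta>: "0 < \<delta>" "\<delta> < 1"
    and zw: "norm (z - w) \<le> \<delta> / 100" and k: "even k" "k \<ge> 4"
  shows "norm (kernel_term k z w \<gamma>) \<le> 4800 * exp (- \<delta>\<^sup>2 * real k / 800)
    * (entry_weight (\<gamma>$1$1) * entry_weight (\<gamma>$2$1) * entry_weight (\<gamma>$2$2))"
proof -
  obtain m where m: "k = 2 * m" using k(1) by (rule evenE)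
  define s where "s = \<delta>\<^sup>2 / 400"
  let ?Q = "displacement \<gamma> z w"
  let ?W = "entry_weight (\<gamma>$1$1) * entry_weight (\<gamma>$2$1) * entry_weight (\<gamma>$2$2)"
  have \<gamma>': "\<gamma> \<in> SL2Z" "\<gamma>$2$1 \<noteq> 0" using \<gamma> by (auto simp: nontranslations_def)
  note zD = F_regionD(1)[OF z]
  have near: "norm (z - w) \<le> 1/4" using zw \<delta> by linarith
  have "\<delta>\<^sup>2 \<le> 1" using \<delta> by (simp add: power_le_one)
  hence s: "0 \<le> s" "s \<le> 1/2" by (auto simp: s_def)
  have "exp s \<le> 1 + \<delta>\<^sup>2 / 200" using real_exp_bound_lemma[OF s] by (simp add: s_def)
  also have "\<dots> \<le> ?Q" by (rule displacement_gap[OF \<gamma>' z \<delta> zw])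
  finally have "(1 / ?Q) ^ m \<le> 3 * (1 / ?Q)\<^sup>2 * exp (- s * real m)"
    using k s m by (intro power_inverse_le_exp) auto
  also have "\<dots> \<le> 3 * (1600 * ?W) * exp (- s * real m)"
    using inverse_displacement_sq_le[OF \<gamma>'(1) zD near]
    by (intro mult_right_mono mult_left_mono) auto
  also have "- s * real m = - \<delta>\<^sup>2 * real k / 800" by (simp add: s_def m)
  finally show ?thesis
    using norm_kernel_term[OF \<gamma>'(1) near_fund_domain_Im(1,2)[OF zD near] k(1)]
    by (simp add: m mult_ac)
qed

lemma nontranslations_entries_inj: "inj_on (\<lambda>\<gamma>. ((\<gamma>$1$1, \<gamma>$2$1), \<gamma>$2$2)) nontranslations"
proof (rule inj_onI)
  fix \<gamma> \<gamma>' :: "int^2^2"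
  assume \<gamma>: "\<gamma> \<in> nontranslations" "\<gamma>' \<in> nontranslations"
    and "((\<gamma>$1$1, \<gamma>$2$1), \<gamma>$2$2) = ((\<gamma>'$1$1, \<gamma>'$2$1), \<gamma>'$2$2)"
  hence eq: "\<gamma>$1$1 = \<gamma>'$1$1" "\<gamma>$2$1 = \<gamma>'$2$1" "\<gamma>$2$2 = \<gamma>'$2$2" by auto
  have "\<gamma>$1$1 * \<gamma>$2$2 - \<gamma>$1$2 * \<gamma>$2$1 = \<gamma>'$1$1 * \<gamma>'$2$2 - \<gamma>'$1$2 * \<gamma>'$2$1"
    using \<gamma> by (simp add: nontranslations_def SL2Z_iff)
  hence "\<gamma>$1$2 = \<gamma>'$1$2" using \<gamma>(2) eq by (simp add: nontranslations_def)
  thus "\<gamma> = \<gamma>'" using eq by (simp add: matrix2_eq_iff)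
qed

lemma nontranslations_sum_le:
  assumes z: "z \<in> F_region \<delta>" and \<delta>: "0 < \<delta>" "\<delta> < 1"
    and zw: "norm (z - w) \<le> \<delta> / 100" and k: "even k" "k \<ge> 4"
  shows "kernel_term k z w summable_on nontranslations"
    and "norm (infsum (kernel_term k z w) nontranslations) \<le>
      4800 * exp (- \<delta>\<^sup>2 * real k / 800) * (infsum entry_weight UNIV) ^ 3"
proof -
  let ?W = "infsum entry_weight UNIV"
  note weight = has_sum_infsum[OF entry_weight_summable]
  have "((\<lambda>((a, c), d). entry_weight a * entry_weight c * entry_weight d) has_sum ?W * ?W * ?W)
      ((UNIV \<times> UNIV) \<times> UNIV)"
    using has_sum_mult_Times[OF has_sum_mult_Times[OF weight _ weight] _ weight]
    by (simp add: entry_weight_nonneg case_prod_unfold)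
  note dominated = infsum_dominated_by_injective_image[OF this _ nontranslations_entries_inj,
      of "4800 * exp (- \<delta>\<^sup>2 * real k / 800)" "kernel_term k z w"]
  show "kernel_term k z w summable_on nontranslations"
    using nontranslation_term_le[OF _ z \<delta> zw k]
    by (intro dominated(1)) (auto simp: entry_weight_nonneg)
  show "norm (infsum (kernel_term k z w) nontranslations) \<le>
      4800 * exp (- \<delta>\<^sup>2 * real k / 800) * ?W ^ 3"
    unfolding power3_eq_cube using nontranslation_term_le[OF _ z \<delta> zw k]
    by (intro dominated(2)) (auto simp: entry_weight_nonneg)
qed

lemma R_kernel_asymptotics:
  assumes z: "z \<in> F_region \<delta>" and \<delta>: "0 < \<delta>" "\<delta> < 1"
    and zw: "norm (z - w) \<le> \<delta> / 100" and k: "even k" "k \<ge> 4"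
  shows "norm (R_kernel k z w - 2 * (2 * \<i> * of_real (sqrt (Im z * Im w)) / (z - cnj w)) ^ k)
    \<le> (84 + 4800 * (infsum entry_weight UNIV) ^ 3)
      * (exp (- \<delta>\<^sup>2 * real k / 800) + Im z * exp (- real k / (17 * (Im z)\<^sup>2)))"
proof -
  let ?M = "2 * (2 * \<i> * of_real (sqrt (Im z * Im w)) / (z - cnj w)) ^ k"
  define A B W where "A = exp (- \<delta>\<^sup>2 * real k / 800)"
    and "B = Im z * exp (- real k / (17 * (Im z)\<^sup>2))" and "W = (infsum entry_weight UNIV) ^ 3"
  note zD = F_regionD(1)[OF z]
  have near: "norm (z - w) \<le> 1/4" "norm (z - w) \<le> 1/100" using zw \<delta> by linarith+
  note Im = near_fund_domain_Im(1,2)[OF zD near(1)]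
  have "k \<ge> 2" using k(2) by simp
  note translation_part = nontrivial_translations_sum_le[OF zD near(2) k(1) this]
  note other_part = nontranslations_sum_le[OF z \<delta> zw k]
  have "R_kernel k z w - ?M = infsum (kernel_term k z w) nontrivial_translations
      + infsum (kernel_term k z w) nontranslations"
    using R_kernel_decomposition[OF Im k(1) translation_part(1) other_part(1)] by simp
  hence "norm (R_kernel k z w - ?M) \<le> 84 * B + 4800 * A * W"
    using norm_triangle_mono[OF translation_part(2) other_part(2)] by (simp add: A_def B_def W_def)
  moreover have "0 \<le> A" "0 \<le> B" "0 \<le> W"
    using Im by (simp_all add: A_def B_def W_def infsum_nonneg entry_weight_nonneg)
  hence "84 * B + 4800 * A * W \<le> (84 + 4800 * W) * (A + B)" by (simp add: algebra_simps)
  ultimately show ?thesis unfolding A_def B_def W_def by linarith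
qed

theorem theorem3p3:
  "\<exists>c\<^sub>0 > 0. \<exists>C > 0. \<forall>k::nat. even k \<and> k \<ge> 4 \<longrightarrow>
     (\<forall>\<delta>::real. 0 < \<delta> \<and> \<delta> < 1 \<longrightarrow>
       (\<forall>z \<in> F_region \<delta>. \<forall>w \<in> upper_half_plane. norm (z - w) \<le> c\<^sub>0 * \<delta> \<longrightarrow>
          norm (R_kernel k z w
                - 2 * (2 * \<i> * of_real (sqrt (Im z * Im w)) / (z - cnj w)) ^ k)
          \<le> C * (exp (- c\<^sub>0 * \<delta>\<^sup>2 * real k) + Im z * exp (- real k / (17 * (Im z)\<^sup>2)))))"
proof -
  define C where "C = 84 + 4800 * (infsum entry_weight UNIV) ^ 3"
  have "C > 0" by (simp add: C_def infsum_nonneg entry_weight_nonneg add_pos_nonneg)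
  moreover have "norm (R_kernel k z w
        - 2 * (2 * \<i> * of_real (sqrt (Im z * Im w)) / (z - cnj w)) ^ k)
      \<le> C * (exp (- (1/800) * \<delta>\<^sup>2 * real k) + Im z * exp (- real k / (17 * (Im z)\<^sup>2)))"
    if "even k" "k \<ge> 4" "0 < \<delta>" "\<delta> < 1" "z \<in> F_region \<delta>" "norm (z - w) \<le> 1/800 * \<delta>" for k \<delta> z w
    using R_kernel_asymptotics[of z \<delta> w k] that by (simp add: C_def)
  ultimately show ?thesis by (intro exI[of _ "1/800"] exI[of _ C] conjI) auto
qed

end
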